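(* For every real $r>0$, $${}_2F_1\left(\frac16,\frac56;1;\beta_r\right)=\frac{2}{\pi}\sqrt[4]{1-k_r^2+k_r^4}\;K\left(k_r^2\right).$$
   Context: ${}_2F_1(a,b;c;w)=\sum_{n\ge 0}\frac{(a)_n(b)_n}{(c)_n}\frac{w^n}{n!}$ for $|w|<1$, where $(a)_n=a(a+1)\cdots(a+n-1)$, $(a)_0=1$. $K(w)=\int_0^{\pi/2}\frac{dt}{\sqrt{1-w\sin^2 t}}$ for $0\le w<1$ is the complete elliptic integral of the first kind as a function of the parameter $w$ (the square of the modulus). For real $r>0$, $m_r\in(0,1)$ is the solution of $K(1-m_r)/K(m_r)=\sqrt r$, and $k_r=\sqrt{m_r}$. For real $r>0$, $\beta_r\in(0,1)$ is the solution of $\frac{{}_2F_1(\frac16,\frac56;1;1-\beta_r)}{{}_2F_1(\frac16,\frac56;1;\beta_r)}=\sqrt r$. Fourth roots are positive real roots. *)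

theory Defs
  imports "HOL-Analysis.Analysis"
begin

text \<open>Gauss's hypergeometric series; meaningful for \<open>\<bar>w\<bar> < 1\<close>.\<close>

definition hyp2F1 :: "real \<Rightarrow> real \<Rightarrow> real \<Rightarrow> real \<Rightarrow> real" where
  "hyp2F1 a b c w =
     (\<Sum>n. pochhammer a n * pochhammer b n / pochhammer c n * (w ^ n / fact n))"

text \<open>The complete elliptic integral of the first kind, for \<open>0 \<le> w < 1\<close>.  The argument is the
  parameter, i.e. the square of the modulus.\<close>

definition ellK :: "real \<Rightarrow> real" where
  "ellK w = integral {0..pi/2} (\<lambda>t. 1 / sqrt (1 - w * (sin t)\<^sup>2))"

definition ell_m :: "real \<Rightarrow> real" where
  "ell_m r = (THE m. 0 < m \<and> m < 1 \<and> ellK (1 - m) / ellK m = sqrt r)"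

definition ell_k :: "real \<Rightarrow> real" where
  "ell_k r = sqrt (ell_m r)"

definition beta6 :: "real \<Rightarrow> real" where
  "beta6 r = (THE b. 0 < b \<and> b < 1 \<and>
     hyp2F1 (1/6) (5/6) 1 (1 - b) / hyp2F1 (1/6) (5/6) 1 b = sqrt r)"

end

theory Submission
  imports Defs
begin

text \<open>
  Let \<open>F\<^sub>a(w)\<close> be the hypergeometric series with parameters \<open>a, 1 - a; 1\<close>, so that
  \<open>K(m) = \<pi>/2 F\<^sub>1\<^sub>/\<^sub>2(m)\<close>.  It satisfies \<open>(w (1 - w) F\<^sub>a')' = a (1 - a) F\<^sub>a\<close>.  With
  \<open>P = 1 - m + m\<^sup>2\<close> there is an increasing bijection \<open>\<beta>\<close> of the unit interval with
  \<open>\<beta>(1 - m) = 1 - \<beta>(m)\<close> such that \<open>F\<^sub>1\<^sub>/\<^sub>6(\<beta>(m))\<close> and \<open>P\<^sup>1\<^sup>/\<^sup>4 F\<^sub>1\<^sub>/\<^sub>2(m)\<close> solve the same linear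
  equation of second order.  Their Wronskian, multiplied by the leading coefficient, is constant and
  vanishes at the singular point \<open>0\<close>, so the two functions are proportional, hence equal.  As
  \<open>P\<close> is invariant under \<open>m \<mapsto> 1 - m\<close>, the quotients defining \<open>m\<^sub>r\<close> and \<open>\<beta>\<^sub>r\<close> agree at \<open>m\<close> and
  \<open>\<beta>(m)\<close>.  These quotients are strictly decreasing from infinity to \<open>0\<close>, which gives
  \<open>\<beta>\<^sub>r = \<beta>(m\<^sub>r)\<close>.
\<close>

subsection \<open>The series with parameters \<open>a, 1 - a; 1\<close>\<close>

definition hypc :: "real \<Rightarrow> nat \<Rightarrow> real" where
  "hypc a n = pochhammer a n * pochhammer (1 - a) n / (fact n)\<^sup>2"

definition hypF :: "real \<Rightarrow> real \<Rightarrow> real" where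
  "hypF a w = (\<Sum>n. hypc a n * w ^ n)"

definition hypF' :: "real \<Rightarrow> real \<Rightarrow> real" where
  "hypF' a w = (\<Sum>n. diffs (hypc a) n * w ^ n)"

lemma hyp2F1_eq_hypF: "hyp2F1 a (1 - a) 1 w = hypF a w"
  by (simp add: hyp2F1_def hypF_def hypc_def pochhammer_fact[symmetric] power2_eq_square field_simps)

lemma hypc_0 [simp]: "hypc a 0 = 1"
  by (simp add: hypc_def)

text \<open>The parameters add up to 1, so (a + n)(1 - a + n) is n (n + 1) plus the constant a (1 -
  a); this splitting is what makes the differential equation self-adjoint.\<close>

lemma hypc_Suc:
  "(real n + 1)\<^sup>2 * hypc a (Suc n) = (real n * (real n + 1) + a * (1 - a)) * hypc a n"
proof -
  have "hypc a (Suc n) = (a + n) * (1 - a + n) * hypc a n / (real n + 1)\<^sup>2"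
    by (simp add: hypc_def pochhammer_Suc power_mult_distrib power2_eq_square add.commute mult_ac)
  moreover have "(a + n) * (1 - a + n) = real n * (real n + 1) + a * (1 - a)"
    by (simp add: algebra_simps)
  ultimately show ?thesis
    by simp
qed

lemma hypc_pos: "0 < a \<Longrightarrow> a < 1 \<Longrightarrow> 0 < hypc a n"
  by (simp add: hypc_def pochhammer_pos)

lemma hypc_le_1:
  assumes "0 < a" "a < 1"
  shows "hypc a n \<le> 1"
proof (induction n)
  case (Suc n)
  \<comment> \<open>(n + 1)^2 exceeds n (n + 1) by n + 1, which is at least a (1 - a).\<close>
  have "a * (1 - a) \<le> 1 * 1"
    by (rule mult_mono) (use assms in auto)
  then have "real n * (real n + 1) + a * (1 - a) \<le> (real n + 1)\<^sup>2"
    by (simp add: power2_eq_square algebra_simps)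
  then have "(real n + 1)\<^sup>2 * hypc a (Suc n) \<le> (real n + 1)\<^sup>2 * 1"
    unfolding hypc_Suc
    by (intro mult_mono Suc.IH) (use hypc_pos[OF assms, of n] in auto)
  then show ?case
    by (subst (asm) mult_le_cancel_left_pos) auto
qed simp

lemma summable_bounded_coeffs:
  fixes c :: "nat \<Rightarrow> real"
  assumes "\<And>n. \<bar>c n\<bar> \<le> 1" "\<bar>w\<bar> < 1"
  shows "summable (\<lambda>n. c n * w ^ n)"
proof (rule summable_comparison_test')
  show "summable (\<lambda>n. \<bar>w\<bar> ^ n)"
    using assms(2) by (intro summable_geometric) auto
  show "norm (c n * w ^ n) \<le> \<bar>w\<bar> ^ n" for n
    using mult_right_mono[OF assms(1)[of n], of "\<bar>w\<bar> ^ n"]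
    by (simp add: abs_mult power_abs)
qed

lemma DERIV_bounded_coeffs:
  fixes c :: "nat \<Rightarrow> real"
  assumes "\<And>n. \<bar>c n\<bar> \<le> 1" "\<bar>w\<bar> < 1"
  shows "DERIV (\<lambda>w. \<Sum>n. c n * w ^ n) w :> (\<Sum>n. diffs c n * w ^ n)"
    and "summable (\<lambda>n. diffs c n * w ^ n)"
proof -
  obtain K where K: "\<bar>w\<bar> < K" "K < 1"
    using dense assms(2) by blast
  then have s: "summable (\<lambda>n. c n * K ^ n)"
    by (intro summable_bounded_coeffs assms) auto
  then show "DERIV (\<lambda>w. \<Sum>n. c n * w ^ n) w :> (\<Sum>n. diffs c n * w ^ n)"
    using K by (intro termdiffs_strong[of c K]) auto
  show "summable (\<lambda>n. diffs c n * w ^ n)"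
    by (rule termdiff_converges[of w 1]) (use assms summable_bounded_coeffs in auto)
qed

lemma DERIV_hypF:
  assumes "0 < a" "a < 1" "\<bar>w\<bar> < 1"
  shows "DERIV (hypF a) w :> hypF' a w"
proof -
  have "\<bar>hypc a n\<bar> \<le> 1" for n
    using hypc_le_1[of a n] hypc_pos[of a n] assms by simp
  then show ?thesis
    using DERIV_bounded_coeffs(1)[of "hypc a" w] assms
    unfolding hypF_def [abs_def] hypF'_def by simp
qed

text \<open>The function w (1 - w) F' is itself a power series with bounded coefficients, so
  termwise differentiation applies and no second derivative of \<open>hypF\<close> is
  needed.\<close>

lemma hypF_ode_self_adjoint:
  assumes "0 < a" "a < 1" "\<bar>w\<bar> < 1"
  shows "DERIV (\<lambda>w. w * (1 - w) * hypF' a w) w :> a * (1 - a) * hypF a w"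
proof -
  \<comment> \<open>Coefficients of the antiderivative of a (1 - a) F that vanishes at 0.\<close>
  define h where "h n = (case n of 0 \<Rightarrow> 0 | Suc k \<Rightarrow> a * (1 - a) * hypc a k / (real k + 1))" for n
  have c: "\<bar>hypc a n\<bar> \<le> 1" "0 < hypc a n" for n
    using hypc_le_1[of a n] hypc_pos[of a n] assms by simp_all
  have aa: "a * (1 - a) \<le> 1 * 1"
    by (rule mult_mono) (use assms in auto)
  have h: "\<bar>h n\<bar> \<le> 1" for n
  proof (cases n)
    case (Suc k)
    have "a * (1 - a) * hypc a k \<le> 1 * 1"
      by (rule mult_mono) (use assms c[of k] aa in auto)
    then show ?thesis
      using Suc assms c(2)[of k] by (simp add: h_def abs_mult field_simps)
  qed (simp add: h_def)
  have eq: "(\<Sum>n. h n * x ^ n) = x * (1 - x) * hypF' a x" if x: "\<bar>x\<bar> < 1" for x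
  proof -
    have "(\<lambda>n. diffs (hypc a) n * x ^ n) sums hypF' a x"
      unfolding hypF'_def using DERIV_bounded_coeffs(2)[OF c(1) x] by (rule summable_sums)
    then have s1: "(\<lambda>n. x * (diffs (hypc a) n * x ^ n)) sums (x * hypF' a x)"
      by (rule sums_mult)
    have "(\<lambda>n. real (Suc n) * hypc a (Suc n) * x ^ Suc n) sums (x * hypF' a x)"
      using s1 by (simp add: diffs_def mult_ac)
    then have "(\<lambda>n. real n * hypc a n * x ^ n) sums (x * hypF' a x)"
      by (subst (asm) sums_Suc_iff) simp
    then have s2: "(\<lambda>n. x * (real n * hypc a n * x ^ n)) sums (x * (x * hypF' a x))"
      by (rule sums_mult)
    \<comment> \<open>The coefficient of x^(n+1) in x (1 - x) F' is (n + 1) c_(n+1) - n c_n; the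
      recurrence identifies it with that of \<open>h\<close>.\<close>
    have "x * (diffs (hypc a) n * x ^ n) - x * (real n * hypc a n * x ^ n) = h (Suc n) * x ^ Suc n" for n
    proof -
      have "(real n + 1) * ((real n + 1) * hypc a (Suc n) - real n * hypc a n) = a * (1 - a) * hypc a n"
        using hypc_Suc[of n a] by (simp add: power2_eq_square algebra_simps)
      then have h: "h (Suc n) = (real n + 1) * hypc a (Suc n) - real n * hypc a n"
        by (simp add: h_def field_simps)
      show ?thesis
        unfolding h by (simp add: diffs_def algebra_simps)
    qed
    then have "(\<lambda>n. h (Suc n) * x ^ Suc n) sums (x * hypF' a x - x * (x * hypF' a x))"
      using sums_diff[OF s1 s2] by simp
    then have "(\<lambda>n. h n * x ^ n) sums (x * hypF' a x - x * (x * hypF' a x))"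
      by (subst (asm) sums_Suc_iff) (simp add: h_def)
    then show ?thesis
      by (simp add: sums_iff algebra_simps)
  qed
  have "diffs h n = a * (1 - a) * hypc a n" for n
    by (simp add: diffs_def h_def add.commute)
  then have "(\<Sum>n. diffs h n * w ^ n) = (\<Sum>n. a * (1 - a) * (hypc a n * w ^ n))"
    by (simp only: mult.assoc)
  also have "\<dots> = a * (1 - a) * hypF a w"
    unfolding hypF_def using summable_bounded_coeffs[OF c(1) assms(3)] by (rule suminf_mult)
  finally have "DERIV (\<lambda>w. \<Sum>n. h n * w ^ n) w :> a * (1 - a) * hypF a w"
    using DERIV_bounded_coeffs(1)[of h w, OF h assms(3)] by simp
  then show ?thesis
  proof (rule has_field_derivative_transform_within_open)
    show "open {-1<..<1::real}" by simp
    show "w \<in> {-1<..<1}"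
      using assms(3) by auto
    show "(\<Sum>n. h n * x ^ n) = x * (1 - x) * hypF' a x" if "x \<in> {-1<..<1}" for x
      by (rule eq) (use that in auto)
  qed
qed

subsection \<open>Monotonicity and the quotient of complementary values\<close>

lemma hypF_0 [simp]: "hypF a 0 = 1"
  by (simp add: hypF_def)

lemma hypF_strict_mono:
  assumes "0 < a" "a < 1" "0 \<le> x" "x < y" "y < 1"
  shows "hypF a x < hypF a y"
proof -
  have c: "\<bar>hypc a n\<bar> \<le> 1" "0 < hypc a n" for n
    using hypc_le_1[of a n] hypc_pos[of a n] assms by simp_all
  have sx: "summable (\<lambda>n. hypc a n * x ^ n)" and sy: "summable (\<lambda>n. hypc a n * y ^ n)"
    using summable_bounded_coeffs[OF c(1)] assms by auto
  have "0 < (\<Sum>n. hypc a n * y ^ n - hypc a n * x ^ n)"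
  proof (rule suminf_pos2[where i = 1])
    show "summable (\<lambda>n. hypc a n * y ^ n - hypc a n * x ^ n)"
      by (rule summable_diff[OF sy sx])
    show "0 \<le> hypc a n * y ^ n - hypc a n * x ^ n" for n
      using mult_left_mono[OF power_mono[of x y n], of "hypc a n"] c(2)[of n] assms by simp
    show "0 < hypc a 1 * y ^ 1 - hypc a 1 * x ^ 1"
      using c(2)[of 1] assms by simp
  qed
  also have "\<dots> = hypF a y - hypF a x"
    unfolding hypF_def by (rule suminf_diff[OF sy sx, symmetric])
  finally show ?thesis by simp
qed

lemma hypF_mono:
  assumes "0 < a" "a < 1" "0 \<le> x" "x \<le> y" "y < 1"
  shows "hypF a x \<le> hypF a y"
  using hypF_strict_mono[of a x y] assms by (cases "x = y") auto

lemma hypF_ge_1: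
  assumes "0 < a" "a < 1" "0 \<le> x" "x < 1"
  shows "1 \<le> hypF a x"
  using hypF_mono[of a 0 x] assms by simp

text \<open>As F >= 1, integrating the self-adjoint equation from 0 gives x (1 - x) F'(x) >= a (1 -
  a) x.\<close>

lemma hypF'_ge:
  assumes "0 < a" "a < 1" "0 < x" "x < 1"
  shows "a * (1 - a) / (1 - x) \<le> hypF' a x"
proof -
  let ?g = "\<lambda>w. w * (1 - w) * hypF' a w - a * (1 - a) * w"
  have "?g 0 \<le> ?g x"
  proof (rule DERIV_nonneg_imp_nondecreasing[of 0 x ?g])
    fix t assume t: "0 \<le> t" "t \<le> x"
    have "DERIV ?g t
            :> a * (1 - a) * hypF a t - a * (1 - a) * 1"
      using assms t by (intro DERIV_diff hypF_ode_self_adjoint DERIV_cmult DERIV_ident) auto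
    moreover have "a * (1 - a) * hypF a t - a * (1 - a) * 1 \<ge> 0"
      using mult_left_mono[OF hypF_ge_1[of a t], of "a * (1 - a)"] assms t by simp
    ultimately show "\<exists>y. DERIV ?g t :> y \<and> y \<ge> 0"
      by blast
  qed (use assms in auto)
  then have "x * (a * (1 - a)) \<le> x * ((1 - x) * hypF' a x)"
    by (simp add: mult_ac)
  then have "a * (1 - a) \<le> (1 - x) * hypF' a x"
    using assms by (subst (asm) mult_le_cancel_left_pos) auto
  then show ?thesis
    using assms by (simp add: field_simps)
qed

text \<open>Integrating \<open>hypF'_ge\<close> yields logarithmic growth at 1, which makes the
  quotient of complementary values unbounded near 0.\<close>

lemma hypF_ge_ln:
  assumes "0 < a" "a < 1" "0 < x" "x < 1"
  shows "1 - a * (1 - a) * ln (1 - x) \<le> hypF a x"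
proof -
  let ?f = "\<lambda>w. hypF a w + a * (1 - a) * ln (1 - w)"
  have d: "DERIV ?f t :> hypF' a t - a * (1 - a) / (1 - t)" if "0 \<le> t" "t \<le> x" for t
    using assms that by (auto intro!: derivative_eq_intros DERIV_hypF simp: divide_inverse algebra_simps)
  have "?f 0 \<le> ?f x"
  proof (rule DERIV_nonneg_imp_increasing_open[of 0 x ?f])
    show "continuous_on {0..x} ?f"
      by (rule DERIV_continuous_on[OF has_field_derivative_at_within[OF d]]) auto
    show "\<exists>y. DERIV ?f t :> y \<and> y \<ge> 0" if "0 < t" "t < x" for t
      using d[of t] hypF'_ge[of a t] assms that by force
  qed (use assms in auto)
  then show ?thesis by simp
qed

lemma continuous_on_hypF:
  assumes "0 < a" "a < 1" "S \<subseteq> {-1<..<1}"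
  shows "continuous_on S (hypF a)"
  by (rule DERIV_continuous_on[OF has_field_derivative_at_within[OF DERIV_hypF]]) (use assms in force)+

lemma hypF_ratio_strict_antimono:
  assumes "0 < a" "a < 1" "0 < x" "x < y" "y < 1"
  shows "hypF a (1 - y) / hypF a y < hypF a (1 - x) / hypF a x"
  using hypF_strict_mono[of a x y] hypF_strict_mono[of a "1 - y" "1 - x"]
    hypF_ge_1[of a x] hypF_ge_1[of a "1 - y"] assms
  by (intro frac_less) auto

lemma hypF_ratio_unique:
  assumes "0 < a" "a < 1" "0 < x" "x < 1" "0 < y" "y < 1"
    and "hypF a (1 - x) / hypF a x = hypF a (1 - y) / hypF a y"
  shows "x = y"
  using hypF_ratio_strict_antimono[of a x y] hypF_ratio_strict_antimono[of a y x] assms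
  by (cases x y rule: linorder_cases) auto

lemma hypF_ratio_large:
  assumes "0 < a" "a < 1" "0 < s"
  obtains x where "0 < x" "x \<le> 1/2" "s \<le> hypF a (1 - x) / hypF a x"
proof -
  define M where "M = s * hypF a (1/2)"
  \<comment> \<open>The exponential makes - a (1 - a) ln x at least \<open>M\<close>, while x <= 1/2
    keeps s F(x) at most \<open>M\<close>.\<close>
  define x where "x = min (1/2) (exp (- (M / (a * (1 - a)))))"
  have x: "0 < x" "x \<le> 1/2"
    by (auto simp: x_def)
  have "x \<le> exp (- (M / (a * (1 - a))))"
    by (simp add: x_def)
  then have "ln x \<le> - (M / (a * (1 - a)))"
    using x by (metis exp_gt_zero ln_exp ln_le_cancel_iff)
  then have "a * (1 - a) * ln x \<le> - M"
    using assms by (simp add: field_simps)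
  then have "M \<le> hypF a (1 - x)"
    using hypF_ge_ln[of a "1 - x"] assms x by simp
  moreover have "s * hypF a x \<le> M"
    unfolding M_def using assms x by (intro mult_left_mono hypF_mono) auto
  ultimately have "s \<le> hypF a (1 - x) / hypF a x"
    using hypF_ge_1[of a x] assms x by (simp add: field_simps)
  with x that show ?thesis by blast
qed

lemma hypF_ratio_surj:
  assumes "0 < a" "a < 1" "0 < s"
  obtains x where "0 < x" "x < 1" "hypF a (1 - x) / hypF a x = s"
proof -
  obtain x where x: "0 < x" "x \<le> 1/2" "s \<le> hypF a (1 - x) / hypF a x"
    using hypF_ratio_large assms by blast
  \<comment> \<open>Reflection inverts the quotient: a value of at least 1/s at y is one of at most
    s at 1 - y. The bounds by 1/2 ensure x <= 1 - y.\<close>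
  obtain y where y: "0 < y" "y \<le> 1/2" "1 / s \<le> hypF a (1 - y) / hypF a y"
    using hypF_ratio_large[of a "1/s"] assms by auto
  have pos: "0 < hypF a t" if "0 \<le> t" "t < 1" for t
    using hypF_ge_1[of a t] assms that by simp
  have "hypF a (1 - (1 - y)) / hypF a (1 - y) \<le> s"
    using y assms pos[of y] pos[of "1 - y"] by (simp add: field_simps)
  moreover have "continuous_on {x..1 - y} (\<lambda>t. hypF a (1 - t) / hypF a t)"
  proof (intro continuous_on_divide ballI)
    show "continuous_on {x..1 - y} (\<lambda>t. hypF a (1 - t))"
      using x y by (intro continuous_on_compose2[OF continuous_on_hypF[OF assms(1,2), of "{-1<..<1}"]]
        continuous_intros) auto
    show "continuous_on {x..1 - y} (hypF a)"
      using x y assms by (intro continuous_on_hypF) auto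
    show "hypF a t \<noteq> 0" if "t \<in> {x..1 - y}" for t
      using pos[of t] that x y by auto
  qed
  ultimately obtain t where "x \<le> t" "t \<le> 1 - y" "hypF a (1 - t) / hypF a t = s"
    using IVT2'[of "\<lambda>t. hypF a (1 - t) / hypF a t" "1 - y" s x] x y by auto
  with x y that[of t] show ?thesis by auto
qed

subsection \<open>The complete elliptic integral\<close>

lemma has_integral_sin_even_power:
  "((\<lambda>t. sin t ^ (2 * n)) has_integral (pi / 2 * (pochhammer (1/2) n / fact n))) {0..pi/2}"
proof (induction n)
  case 0
  show ?case
    using has_integral_const_real[of "1::real" 0 "pi/2"] by simp
next
  case (Suc n)
  \<comment> \<open>The Wallis recursion: \<open>?F\<close> vanishes at both endpoints, and its
    derivative involves only two consecutive even powers of the sine.\<close>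
  let ?F = "\<lambda>t::real. - cos t * sin t ^ (2 * n + 1)"
  have "((\<lambda>t. real (2 * n + 2) * sin t ^ (2 * n + 2) - real (2 * n + 1) * sin t ^ (2 * n))
          has_integral (?F (pi/2) - ?F 0)) {0..pi/2}"
  proof (rule fundamental_theorem_of_calculus)
    fix t :: real
    have "((\<lambda>t. sin t ^ (2 * n + 1)) has_real_derivative real (2 * n + 1) * (cos t * sin t ^ (2 * n)))
        (at t within {0..pi/2})"
      using DERIV_power[OF has_field_derivative_at_within[OF DERIV_sin], where n = "2 * n + 1" and x = t] by simp
    from DERIV_mult[OF DERIV_minus[OF has_field_derivative_at_within[OF DERIV_cos]] this]
    have "(?F has_real_derivative
        sin t * sin t ^ (2 * n + 1) - real (2 * n + 1) * ((cos t)\<^sup>2 * sin t ^ (2 * n))) (at t within {0..pi/2})"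
      by (simp add: power2_eq_square mult_ac)
    moreover have "sin t * sin t ^ (2 * n + 1) - real (2 * n + 1) * ((cos t)\<^sup>2 * sin t ^ (2 * n))
        = real (2 * n + 2) * sin t ^ (2 * n + 2) - real (2 * n + 1) * sin t ^ (2 * n)"
      unfolding cos_squared_eq by (simp add: power2_eq_square algebra_simps)
    ultimately have "(?F has_real_derivative
        (real (2 * n + 2) * sin t ^ (2 * n + 2) - real (2 * n + 1) * sin t ^ (2 * n))) (at t within {0..pi/2})"
      by (simp only:)
    then show "(?F has_vector_derivative
        (real (2 * n + 2) * sin t ^ (2 * n + 2) - real (2 * n + 1) * sin t ^ (2 * n))) (at t within {0..pi/2})"
      by (simp add: has_real_derivative_iff_has_vector_derivative)
  qed auto
  from has_integral_add[OF this has_integral_mult_right[OF Suc.IH, of "real (2 * n + 1)"]]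
  have "((\<lambda>t. real (2 * n + 2) * sin t ^ (2 * n + 2)) has_integral
          real (2 * n + 1) * (pi / 2 * (pochhammer (1/2) n / fact n))) {0..pi/2}"
    by simp
  from has_integral_mult_right[OF this, of "1 / real (2 * n + 2)"]
  have "((\<lambda>t. sin t ^ (2 * Suc n)) has_integral
          1 / real (2 * n + 2) * (real (2 * n + 1) * (pi / 2 * (pochhammer (1/2) n / fact n)))) {0..pi/2}"
    by (simp add: add_divide_distrib[symmetric] del: of_nat_add of_nat_mult of_nat_Suc)
  moreover have "1 / real (2 * n + 2) * (real (2 * n + 1) * (pi / 2 * (pochhammer (1/2) n / fact n)))
      = pi / 2 * (pochhammer (1/2) (Suc n) / fact (Suc n))"
    by (simp add: pochhammer_Suc field_simps)
  ultimately show ?case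
    by (simp only:)
qed

lemma inverse_sqrt_series:
  fixes x :: real
  assumes "\<bar>x\<bar> < 1"
  shows "(\<lambda>n. pochhammer (1/2) n / fact n * x ^ n) sums (1 / sqrt (1 - x))"
proof -
  have "(\<lambda>n. ((-1/2) gchoose n) * (-x) ^ n) sums (1 + -x) powr (-1/2)"
    using gen_binomial_real[of "-x" "-1/2"] assms by simp
  moreover have "((-1/2) gchoose n) * (-x) ^ n = pochhammer (1/2) n / fact n * x ^ n" for n
    by (simp add: gbinomial_pochhammer power_minus[of x])
  moreover have "(1 + -x) powr (-1/2) = 1 / sqrt (1 - x)"
    using powr_minus_divide[of "1 - x" "1/2"] assms by (simp add: powr_half_sqrt)
  ultimately show ?thesis by simp
qed

text \<open>The factor \<open>p n\<close> enters twice, from the binomial series and from the Wallis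
  integral, and its square is \<open>hypc (1/2) n\<close>.\<close>

lemma ellK_eq_hypF:
  assumes "0 \<le> w" "w < 1"
  shows "ellK w = pi / 2 * hypF (1/2) w"
proof -
  define p :: "nat \<Rightarrow> real" where "p n = pochhammer (1/2) n / fact n" for n
  have p2: "(p n)\<^sup>2 = hypc (1/2) n" for n
    by (simp add: p_def hypc_def power2_eq_square)
  have p1: "\<bar>p n\<bar> \<le> 1" for n
    using hypc_le_1[of "1/2" n] p2[of n] abs_square_le_1[of "p n"] by simp
  define f where "f n t = (\<Sum>i<n. p i * (w * (sin t)\<^sup>2) ^ i)" for n and t :: real
  have sin2: "w * (sin t)\<^sup>2 \<le> w" for t :: real
    using mult_left_mono[of "(sin t)\<^sup>2" 1 w] assms abs_square_le_1[of "sin t"] by simp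
  \<comment> \<open>The geometric majorant w^i is uniform in t and justifies integrating
    termwise.\<close>
  have "uniform_limit {0..pi/2} f (\<lambda>t. \<Sum>i. p i * (w * (sin t)\<^sup>2) ^ i) sequentially"
    unfolding f_def [abs_def]
  proof (rule Weierstrass_m_test)
    show "summable (\<lambda>i. w ^ i)"
      using assms by (intro summable_geometric) auto
    show "norm (p i * (w * (sin t)\<^sup>2) ^ i) \<le> w ^ i" for i t
      using mult_mono[OF p1[of i] power_mono[OF sin2[of t], of i]] assms
      by (simp add: abs_mult power_abs)
  qed
  moreover have "(\<Sum>i. p i * (w * (sin t)\<^sup>2) ^ i) = 1 / sqrt (1 - w * (sin t)\<^sup>2)" for t
    using inverse_sqrt_series[of "w * (sin t)\<^sup>2"] sin2[of t] assms by (simp add: p_def sums_iff)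
  ultimately have u: "uniform_limit {0..pi/2} f (\<lambda>t. 1 / sqrt (1 - w * (sin t)\<^sup>2)) sequentially"
    by simp
  have "continuous_on {0..pi/2} (f n)" for n
    unfolding f_def [abs_def] by (intro continuous_intros)
  from uniform_limit_integral[OF u this] obtain I J where
    I: "\<And>n. (f n has_integral I n) {0..pi/2}" and
    J: "((\<lambda>t. 1 / sqrt (1 - w * (sin t)\<^sup>2)) has_integral J) {0..pi/2}" and lim: "I \<longlonglongrightarrow> J"
    by auto
  have "(f n has_integral (\<Sum>i<n. p i * w ^ i * (pi / 2 * p i))) {0..pi/2}" for n
  proof -
    have "((\<lambda>t. \<Sum>i<n. p i * w ^ i * sin t ^ (2 * i)) has_integral
            (\<Sum>i<n. p i * w ^ i * (pi / 2 * p i))) {0..pi/2}"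
      unfolding p_def by (intro has_integral_sum has_integral_mult_right has_integral_sin_even_power) auto
    moreover have "p i * (w * (sin t)\<^sup>2) ^ i = p i * w ^ i * sin t ^ (2 * i)" for i t
      by (simp add: power_mult_distrib power_mult)
    ultimately show ?thesis
      by (simp only: f_def [abs_def])
  qed
  then have "I n = (\<Sum>i<n. p i * w ^ i * (pi / 2 * p i))" for n
    using has_integral_unique[OF I[of n]] by blast
  moreover have "p i * w ^ i * (pi / 2 * p i) = pi / 2 * (hypc (1/2) i * w ^ i)" for i
    by (simp add: power2_eq_square flip: p2)
  ultimately have "I n = (\<Sum>i<n. pi / 2 * (hypc (1/2) i * w ^ i))" for n
    by (simp only:)
  then have "I = (\<lambda>n. \<Sum>i<n. pi / 2 * (hypc (1/2) i * w ^ i))"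
    by (rule ext)
  with lim have "(\<lambda>i. pi / 2 * (hypc (1/2) i * w ^ i)) sums J"
    by (simp only: sums_def)
  moreover have "\<bar>hypc (1/2) i\<bar> \<le> 1" for i
    using hypc_le_1[of "1/2" i] hypc_pos[of "1/2" i] by simp
  then have "summable (\<lambda>i. hypc (1/2) i * w ^ i)"
    using assms by (intro summable_bounded_coeffs) auto
  then have "(\<lambda>i. pi / 2 * (hypc (1/2) i * w ^ i)) sums (pi / 2 * hypF (1/2) w)"
    unfolding hypF_def by (intro sums_mult summable_sums)
  ultimately have "J = pi / 2 * hypF (1/2) w"
    by (rule sums_unique2)
  with J show ?thesis
    unfolding ellK_def by (simp add: integral_unique)
qed

subsection \<open>The transformation between the two series\<close>

definition quart :: "real \<Rightarrow> real" where
  "quart m = root 4 (1 - m + m\<^sup>2)"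

text \<open>The branch with \<open>\<beta>(0) = 0\<close> of \<open>4 \<beta> (1 - \<beta>) = 1728/j\<close>, where
  \<open>j = 256 (1 - m + m\<^sup>2)\<^sup>3 / (m (1 - m))\<^sup>2\<close> is Klein's invariant of the curve with parameter \<open>m\<close>.\<close>

definition beta_map :: "real \<Rightarrow> real" where
  "beta_map m = 1/2 - (2 - 3 * m - 3 * m\<^sup>2 + 2 * m ^ 3) * (1 / quart m) ^ 6 / 4"

lemma quadratic_pos: "0 < 1 - m + m\<^sup>2" for m :: real
proof -
  have "1 - m + m\<^sup>2 = (m - 1/2)\<^sup>2 + 3/4"
    by (simp add: power2_eq_square algebra_simps)
  then show ?thesis
    using zero_le_power2[of "m - 1/2"] by linarith
qed

lemma quart_pos: "0 < quart m"
  by (simp add: quart_def quadratic_pos)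

lemma quart_pow4: "quart m ^ 4 = 1 - m + m\<^sup>2"
  using quadratic_pos[of m] by (simp add: quart_def)

text \<open>With s = \<open>quart m\<close> and r = 1/s, these two relations turn the later
  verifications into polynomial identities in m, s and r.\<close>

lemma quart_recip: "quart m * (1 / quart m) = 1" "(1 / quart m) ^ 4 * (1 - m + m\<^sup>2) = 1"
  using quart_pos[of m] by (simp_all add: power_divide flip: quart_pow4)

lemma quart_reflect: "quart (1 - m) = quart m"
  by (simp add: quart_def power2_eq_square algebra_simps)

lemma DERIV_quart: "DERIV quart m :> (2 * m - 1) / 4 * (1 / quart m) ^ 3"
proof -
  have "DERIV (\<lambda>m. root 4 (1 - m + m\<^sup>2)) m :>
          inverse (real 4 * root 4 (1 - m + m\<^sup>2) ^ (4 - Suc 0)) * (2 * m - 1)"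
    by (rule DERIV_chain2[OF DERIV_real_root])
      (auto intro!: derivative_eq_intros simp: quadratic_pos)
  then show ?thesis
    by (simp add: quart_def [abs_def] field_simps)
qed

lemma DERIV_quart_recip: "DERIV (\<lambda>m. 1 / quart m) m :> - (2 * m - 1) / 4 * (1 / quart m) ^ 5"
  using quart_pos[of m] DERIV_quart[of m]
  by (auto intro!: derivative_eq_intros simp: field_simps eval_nat_numeral)

lemma DERIV_quart_recip_power:
  assumes "0 < n"
  shows "DERIV (\<lambda>m. (1 / quart m) ^ n) m :> - real n * (2 * m - 1) / 4 * (1 / quart m) ^ (n + 4)"
proof -
  have "n + 4 = 5 + (n - Suc 0)"
    using assms by simp
  then show ?thesis
    by (intro DERIV_cong[OF DERIV_power[OF DERIV_quart_recip]]) (simp only: power_add, simp add: algebra_simps)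
qed

lemma DERIV_beta_map: "DERIV beta_map m :> 27 / 8 * (m * (1 - m)) * (1 / quart m) ^ 10"
proof -
  define r where "r = 1 / quart m"
  have P: "r ^ 4 * (1 - m + m\<^sup>2) = 1"
    using quart_recip(2) by (simp add: r_def)
  have "DERIV (\<lambda>m. 2 - 3 * m - 3 * m\<^sup>2 + 2 * m ^ 3) m :> - 3 - 6 * m + 6 * m\<^sup>2"
    by (auto intro!: derivative_eq_intros)
  from DERIV_diff[OF DERIV_const[of "1/2"] DERIV_cdivide[OF DERIV_mult[OF this DERIV_quart_recip_power[of 6]], of 4]]
  have "DERIV beta_map m :> 0 - ((- 3 - 6 * m + 6 * m\<^sup>2) * r ^ 6
      + (- real 6 * (2 * m - 1) / 4 * r ^ (6 + 4)) * (2 - 3 * m - 3 * m\<^sup>2 + 2 * m ^ 3)) / 4"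
    unfolding beta_map_def [abs_def] r_def by (simp only: zero_less_numeral)
  \<comment> \<open>The factor 1 is made explicit so that r^4 (1 - m + m^2) can replace it, which
    brings every term to r^10.\<close>
  also have "0 - ((- 3 - 6 * m + 6 * m\<^sup>2) * r ^ 6
      + (- real 6 * (2 * m - 1) / 4 * r ^ (6 + 4)) * (2 - 3 * m - 3 * m\<^sup>2 + 2 * m ^ 3)) / 4
    = - ((- 3 - 6 * m + 6 * m\<^sup>2) * r ^ 6 * 1
      + (- 3 * (2 * m - 1) / 2 * r ^ 10) * (2 - 3 * m - 3 * m\<^sup>2 + 2 * m ^ 3)) / 4"
    by (simp add: field_simps)
  also have "\<dots>
    = - ((- 3 - 6 * m + 6 * m\<^sup>2) * r ^ 6 * (r ^ 4 * (1 - m + m\<^sup>2))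
      + (- 3 * (2 * m - 1) / 2 * r ^ 10) * (2 - 3 * m - 3 * m\<^sup>2 + 2 * m ^ 3)) / 4"
    by (simp only: P)
  also have "\<dots> = 27 / 8 * (m * (1 - m)) * r ^ 10"
    by algebra
  finally show ?thesis by (simp add: r_def)
qed

text \<open>The polynomial identity behind this is the discriminant formula for the cubic with roots
  0, 1 and m.\<close>

lemma beta_map_mult_reflect:
  "beta_map m * (1 - beta_map m) = 27 / 16 * (m * (1 - m))\<^sup>2 * (1 / quart m) ^ 12"
proof -
  define r where "r = 1 / quart m"
  have P: "r ^ 4 * (1 - m + m\<^sup>2) = 1"
    using quart_recip(2) by (simp add: r_def)
  have "beta_map m * (1 - beta_map m)
      = 1 / 4 - (2 - 3 * m - 3 * m\<^sup>2 + 2 * m ^ 3)\<^sup>2 * r ^ 12 / 16"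
    unfolding beta_map_def r_def [symmetric] by algebra
  also have "(1::real) / 4 = (r ^ 4 * (1 - m + m\<^sup>2)) ^ 3 / 4"
    by (simp only: P power_one)
  also have "(r ^ 4 * (1 - m + m\<^sup>2)) ^ 3 / 4 - (2 - 3 * m - 3 * m\<^sup>2 + 2 * m ^ 3)\<^sup>2 * r ^ 12 / 16
      = (4 * (1 - m + m\<^sup>2) ^ 3 - (2 - 3 * m - 3 * m\<^sup>2 + 2 * m ^ 3)\<^sup>2) / 16 * r ^ 12"
    by (simp add: power_mult_distrib left_diff_distrib diff_divide_distrib)
  also have "4 * (1 - m + m\<^sup>2) ^ 3 - (2 - 3 * m - 3 * m\<^sup>2 + 2 * m ^ 3)\<^sup>2 = 27 * (m * (1 - m))\<^sup>2"
    by algebra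
  finally show ?thesis by (simp add: r_def mult_ac)
qed

lemma beta_map_0 [simp]: "beta_map 0 = 0"
  by (simp add: beta_map_def quart_def)

lemma beta_map_reflect: "beta_map (1 - m) = 1 - beta_map m"
proof -
  have "2 - 3 * (1 - m) - 3 * (1 - m)\<^sup>2 + 2 * (1 - m) ^ 3 = - (2 - 3 * m - 3 * m\<^sup>2 + 2 * m ^ 3)"
    by algebra
  then show ?thesis
    unfolding beta_map_def quart_reflect by (simp only:)
qed

text \<open>The derivative vanishes at 0 and 1, so its sign is used on the open interval only;
  continuity covers the ends.\<close>

lemma beta_map_strict_mono:
  assumes "0 \<le> x" "x < y" "y \<le> 1"
  shows "beta_map x < beta_map y"
proof (rule DERIV_pos_imp_increasing_open[OF assms(2)])
  show "\<exists>D. DERIV beta_map t :> D \<and> D > 0" if "x < t" "t < y" for t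
    using DERIV_beta_map[of t] quart_pos[of t] assms that
    by (intro exI[of _ "27 / 8 * (t * (1 - t)) * (1 / quart t) ^ 10"]) auto
  show "continuous_on {x..y} beta_map"
    by (rule DERIV_continuous_on[OF has_field_derivative_at_within[OF DERIV_beta_map]])
qed

lemma beta_map_bounds:
  assumes "0 < m" "m < 1"
  shows "0 < beta_map m" "beta_map m < 1"
  using beta_map_strict_mono[of 0 m] beta_map_strict_mono[of 0 "1 - m"] assms
  by (auto simp: beta_map_reflect)

text \<open>Here \<open>s = P\<^sup>1\<^sup>/\<^sup>4\<close> and \<open>r = 1/s\<close>, while \<open>f\<close>, \<open>f'\<close> and \<open>G\<close>, \<open>F'\<close> are the values of the series and
  their derivatives at \<open>m\<close> and \<open>\<beta>(m)\<close>; the left-hand side is the derivative of the scaled Wronskian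
  \<open>2 s f H - (h r + m (1 - m) (2 m - 1) f r\<^sup>5 / 4) G\<close>.\<close>

lemma wronskian_algebra:
  fixes m r s f f' F' G :: real
  defines "q \<equiv> m * (1 - m)"
  assumes rs: "s * r = 1" and P: "r ^ 4 * (1 - m + m\<^sup>2) = 1"
  defines "h \<equiv> q * f'" and "H \<equiv> (27 / 16 * q\<^sup>2 * r ^ 12) * F'"
  shows "2 * (((2 * m - 1) / 4 * r ^ 3 * f + f' * s) * H + 5 / 36 * G * (27 / 8 * q * r ^ 10) * (s * f))
       - ((f / 4 * r + (- (2 * m - 1) / 4 * r ^ 5) * h
            + (((- 6 * m\<^sup>2 + 6 * m - 1) * f + f' * (q * (2 * m - 1))) * r ^ 5
                + (- 5 * (2 * m - 1) / 4 * r ^ 9) * (q * (2 * m - 1) * f)) / 4) * G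
          + F' * (27 / 8 * q * r ^ 10) * (h * r + q * (2 * m - 1) * f * r ^ 5 / 4)) = 0"
    (is "?L = 0")
proof -
  \<comment> \<open>The coefficient of f G. Multiplying by powers of r^4 (1 - m + m^2) = 1 raises r
    and r^5 to r^9, and the remaining polynomial in m is zero.\<close>
  have D: "15 / 16 * q * r ^ 9 - r / 4 - (- 6 * m\<^sup>2 + 6 * m - 1) * r ^ 5 / 4
             + 5 / 16 * q * (2 * m - 1)\<^sup>2 * r ^ 9 = 0"
  proof -
    have "r * (r ^ 4 * (1 - m + m\<^sup>2))\<^sup>2 = r ^ 9 * (1 - m + m\<^sup>2)\<^sup>2"
      "r ^ 5 * (r ^ 4 * (1 - m + m\<^sup>2)) = r ^ 9 * (1 - m + m\<^sup>2)"
      by algebra+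
    then have "r = r ^ 9 * (1 - m + m\<^sup>2)\<^sup>2" "r ^ 5 = r ^ 9 * (1 - m + m\<^sup>2)"
      by (simp_all add: P)
    moreover have "15 * q * r ^ 9 - 4 * (r ^ 9 * (1 - m + m\<^sup>2)\<^sup>2)
        - 4 * (- 6 * m\<^sup>2 + 6 * m - 1) * (r ^ 9 * (1 - m + m\<^sup>2)) + 5 * q * (2 * m - 1)\<^sup>2 * r ^ 9 = 0"
      unfolding q_def by algebra
    ultimately have "15 * q * r ^ 9 - 4 * r - 4 * (- 6 * m\<^sup>2 + 6 * m - 1) * r ^ 5
        + 5 * q * (2 * m - 1)\<^sup>2 * r ^ 9 = 0"
      by metis
    then show ?thesis
      by (simp add: field_simps)
  qed
  \<comment> \<open>The terms in f F' and f' G cancel identically.\<close>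
  have "?L = f' * F' * (27 / 8 * q\<^sup>2 * r ^ 11 * (s * r - 1))
      + f * G * (15 / 16 * q * r ^ 9 * (s * r) - r / 4 - (- 6 * m\<^sup>2 + 6 * m - 1) * r ^ 5 / 4
             + 5 / 16 * q * (2 * m - 1)\<^sup>2 * r ^ 9)"
    unfolding h_def H_def by (simp add: field_simps) algebra
  then show ?thesis
    by (simp only: rs D mult_1_right) simp
qed

lemma hypF_sextic_transformation:
  assumes "0 \<le> m" "m < 1"
  shows "hypF (1/6) (beta_map m) = quart m * hypF (1/2) m"
proof (cases "m = 0")
  case True
  then show ?thesis by (simp add: quart_def)
next
  case False
  define h where "h w = w * (1 - w) * hypF' (1/2) w" for w
  define H where "H w = w * (1 - w) * hypF' (1/6) w" for w
  \<comment> \<open>With u = s f and v = G, this is x (1 - x) / s^2 times u v' - u' v, rewritten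
    through \<open>h\<close> and \<open>H\<close>, whose derivatives the self-adjoint equations
    supply.\<close>
  define W where "W x = 2 * (quart x * hypF (1/2) x * H (beta_map x))
    - (h x * (1 / quart x) + x * (1 - x) * (2 * x - 1) * hypF (1/2) x * (1 / quart x) ^ 5 / 4)
       * hypF (1/6) (beta_map x)" for x
  have beta: "\<bar>beta_map x\<bar> < 1" if "0 \<le> x" "x < 1" for x
    using beta_map_bounds[of x] that by (cases "x = 0") auto
  \<comment> \<open>The constants 1/4 here and 5/36 below are a (1 - a) for a = 1/2 and a =
    1/6.\<close>
  have df: "DERIV (hypF (1/2)) x :> hypF' (1/2) x" "DERIV h x :> hypF (1/2) x / 4"
    if "0 \<le> x" "x < 1" for x
    using DERIV_hypF[of "1/2" x] hypF_ode_self_adjoint[of "1/2" x] that by (simp_all add: h_def [abs_def])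
  have dG: "DERIV (\<lambda>x. hypF (1/6) (beta_map x)) x
              :> hypF' (1/6) (beta_map x) * (27 / 8 * (x * (1 - x)) * (1 / quart x) ^ 10)"
    and dH: "DERIV (\<lambda>x. H (beta_map x)) x
              :> 5 / 36 * hypF (1/6) (beta_map x) * (27 / 8 * (x * (1 - x)) * (1 / quart x) ^ 10)"
    if "0 \<le> x" "x < 1" for x
    using DERIV_chain2[OF DERIV_hypF[of "1/6" "beta_map x"] DERIV_beta_map[of x]]
      DERIV_chain2[OF hypF_ode_self_adjoint[of "1/6" "beta_map x"] DERIV_beta_map[of x]] beta[OF that]
    by (simp_all add: H_def)
  have dW: "DERIV W x :> 0" if x: "0 \<le> x" "x < 1" for x
  proof -
    have H: "H (beta_map x) = (27 / 16 * (x * (1 - x))\<^sup>2 * (1 / quart x) ^ 12) * hypF' (1/6) (beta_map x)"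
      unfolding H_def beta_map_mult_reflect ..
    have dq: "DERIV (\<lambda>x. x * (1 - x) * (2 * x - 1)) x :> - 6 * x\<^sup>2 + 6 * x - 1"
      by (auto intro!: derivative_eq_intros simp: algebra_simps power2_eq_square)
    have dr5: "DERIV (\<lambda>x. (1 / quart x) ^ 5) x :> - 5 * (2 * x - 1) / 4 * (1 / quart x) ^ 9"
      using DERIV_quart_recip_power[of 5 x] by simp
    note dW = DERIV_diff[OF DERIV_cmult[OF DERIV_mult[OF DERIV_mult[OF DERIV_quart df(1)[OF x]] dH[OF x]], of 2]
        DERIV_mult[OF DERIV_add[OF DERIV_mult[OF df(2)[OF x] DERIV_quart_recip]
          DERIV_cdivide[OF DERIV_mult[OF DERIV_mult[OF dq df(1)[OF x]] dr5], of 4]] dG[OF x]]]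
    show ?thesis
      unfolding W_def [abs_def]
      by (rule DERIV_cong[OF dW]) (unfold H h_def, rule wronskian_algebra[OF quart_recip])
  qed
  have W: "W x = 0" if x: "0 < x" "x < 1" for x
  proof -
    \<comment> \<open>At 0 every summand of \<open>W\<close> contains a vanishing factor, as
      \<open>beta_map 0 = 0\<close>.\<close>
    have "W x = W 0"
    proof (rule DERIV_isconst_end[of 0 x W])
      show "continuous_on {0..x} W"
        by (rule DERIV_continuous_on[OF has_field_derivative_at_within[OF dW]]) (use x in auto)
    qed (use x dW in auto)
    then show ?thesis
      by (simp add: W_def h_def H_def)
  qed
  \<comment> \<open>The numerator of the derivative of \<open>?R\<close> is the unscaled Wronskian,
    and \<open>?R\<close> is 1 at 0.\<close>
  let ?R = "\<lambda>x. hypF (1/6) (beta_map x) / (quart x * hypF (1/2) x)"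
  have pos: "0 < quart x * hypF (1/2) x" if "0 \<le> x" "x < 1" for x
    using quart_pos[of x] hypF_ge_1[of "1/2" x] that by simp
  have dR: "DERIV ?R x :> (hypF' (1/6) (beta_map x) * (27 / 8 * (x * (1 - x)) * (1 / quart x) ^ 10)
        * (quart x * hypF (1/2) x)
      - hypF (1/6) (beta_map x) * ((2 * x - 1) / 4 * (1 / quart x) ^ 3 * hypF (1/2) x + hypF' (1/2) x * quart x))
      / (quart x * hypF (1/2) x * (quart x * hypF (1/2) x))" if x: "0 \<le> x" "x < 1" for x
    using pos[OF x]
    by (intro DERIV_divide DERIV_mult dG df DERIV_quart x) auto
  have "?R m = ?R 0"
  proof (rule DERIV_isconst_end[of 0 m ?R])
    show "continuous_on {0..m} ?R"
      by (rule DERIV_continuous_on[OF has_field_derivative_at_within[OF dR]]) (use assms in auto)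
    show "DERIV ?R x :> 0" if x: "0 < x" "x < m" for x
    proof -
      define s where "s = quart x"
      define r where "r = 1 / s"
      define q where "q = x * (1 - x)"
      have rs: "s * r = 1"
        using quart_recip(1)[of x] by (simp add: s_def r_def)
      have H: "H (beta_map x) = (27 / 16 * q\<^sup>2 * r ^ 12) * hypF' (1/6) (beta_map x)"
        unfolding H_def beta_map_mult_reflect q_def r_def s_def ..
      have "q \<noteq> 0"
        using x assms by (simp add: q_def)
      have "2 * (s * hypF (1/2) x * H (beta_map x))
        - (h x * r + q * (2 * x - 1) * hypF (1/2) x * r ^ 5 / 4) * hypF (1/6) (beta_map x) = 0"
        using W[of x] x assms by (simp add: W_def s_def r_def q_def)
      moreover have "h x = q * hypF' (1/2) x"
        by (simp add: h_def q_def)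
      \<comment> \<open>Multiply \<open>W x = 0\<close> by s^2 and use s r = 1. Cancelling q then
        requires x > 0; continuity of \<open>?R\<close> handles 0.\<close>
      ultimately have "q * (hypF' (1/6) (beta_map x) * (27 / 8 * q * r ^ 10) * (s * hypF (1/2) x)
        - hypF (1/6) (beta_map x) * ((2 * x - 1) / 4 * r ^ 3 * hypF (1/2) x + hypF' (1/2) x * s)) = 0"
        using rs unfolding H by algebra
      with \<open>q \<noteq> 0\<close> have "hypF' (1/6) (beta_map x) * (27 / 8 * q * r ^ 10) * (s * hypF (1/2) x)
        - hypF (1/6) (beta_map x) * ((2 * x - 1) / 4 * r ^ 3 * hypF (1/2) x + hypF' (1/2) x * s) = 0"
        by simp
      then show ?thesis
        using dR[of x] x assms by (simp add: s_def r_def q_def)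
    qed
  qed (use assms False in auto)
  then show ?thesis
    using pos[of m] assms by (simp add: quart_def field_simps)
qed

section \<open>Identification of the two solutions and conclusion\<close>

theorem theorem3:
  fixes r :: real
  assumes "r > 0"
  shows "hyp2F1 (1/6) (5/6) 1 (beta6 r) =
           2 / pi * root 4 (1 - (ell_k r)\<^sup>2 + (ell_k r) ^ 4) * ellK ((ell_k r)\<^sup>2)"
proof -
  obtain m where m: "0 < m" "m < 1" "hypF (1/2) (1 - m) / hypF (1/2) m = sqrt r"
    using hypF_ratio_surj[of "1/2" "sqrt r"] assms by auto
  have ratio: "ellK (1 - x) / ellK x = hypF (1/2) (1 - x) / hypF (1/2) x" if "0 < x" "x < 1" for x
    using that by (simp add: ellK_eq_hypF)
  have "ell_m r = m"
    unfolding ell_m_def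
  proof (rule the_equality)
    show "0 < m \<and> m < 1 \<and> ellK (1 - m) / ellK m = sqrt r"
      using m ratio by simp
    show "x = m" if "0 < x \<and> x < 1 \<and> ellK (1 - x) / ellK x = sqrt r" for x
      by (rule hypF_ratio_unique[of "1/2"]) (use that m ratio[of x] in simp_all)
  qed
  then have k: "(ell_k r)\<^sup>2 = m" "(ell_k r) ^ 4 = m\<^sup>2"
    using m power_mult[of "sqrt m" 2 2] by (simp_all add: ell_k_def)
  have F: "hyp2F1 (1/6) (5/6) 1 w = hypF (1/6) w" for w
    using hyp2F1_eq_hypF[of "1/6" w] by simp
  have "beta6 r = beta_map m"
    unfolding beta6_def F
  proof (rule the_equality)
    \<comment> \<open>Numerator and denominator acquire the same factor \<open>quart m\<close>, so
      the quotient is the one already known at m.\<close>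
    have "hypF (1/6) (1 - beta_map m) / hypF (1/6) (beta_map m) = sqrt r"
      using hypF_sextic_transformation[of m] hypF_sextic_transformation[of "1 - m"] m quart_pos[of m]
      by (simp add: beta_map_reflect quart_reflect)
    with beta_map_bounds[of m] m
    show b: "0 < beta_map m \<and> beta_map m < 1
        \<and> hypF (1/6) (1 - beta_map m) / hypF (1/6) (beta_map m) = sqrt r"
      by simp
    show "x = beta_map m"
      if "0 < x \<and> x < 1 \<and> hypF (1/6) (1 - x) / hypF (1/6) x = sqrt r" for x
      by (rule hypF_ratio_unique[of "1/6"]) (use that b in simp_all)
  qed
  then show ?thesis
    using hypF_sextic_transformation[of m] m k by (simp add: F ellK_eq_hypF quart_def)
qed

end
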